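(* On any Banach space $X$ (with norm $\|\cdot\|$), there exists a bounded operator $T:X\to X$ such that $\limsup_{n\to\infty} n\,\|T^{n+1}-T^n\|<\infty$ and $\|T^n\|\to\infty$ as $n\to\infty$. Furthermore, there is an equivalent norm $|\cdot|$ on $X$ so that $\limsup_{n\to\infty} n\,|T^{n+1}-T^n|\le \frac1e$.
   Context: All Banach spaces are complex, and operators are linear. For a bounded operator $S$ on $X$, $\|S\|$ and $|S|$ denote the operator norms induced by the norms $\|\cdot\|$ and $|\cdot|$ on $X$ respectively. $e$ is the base of the natural logarithm.
   Formalization: "Any Banach space" is restricted to infinite-dimensional complex Banach spaces; in finite dimensions the claim always fails, since bounded n‖T^{n+1}−T^n‖ forces T to be power bounded (e.g. on X = ℂ). *)

theory Defs
  imports "HOL-Analysis.Analysis"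
begin

text \<open>
  The distribution only provides real Banach spaces (class \<^class>\<open>banach\<close>). A complex
  Banach space is a real one with a complex scalar multiplication that extends the
  real one and for which the norm is homogeneous.
\<close>

class scaleC = scaleR +
  fixes scaleC :: "complex \<Rightarrow> 'a \<Rightarrow> 'a" (infixr "*\<^sub>C" 75)
  assumes scaleR_scaleC: "scaleR r x = scaleC (complex_of_real r) x"

class complex_vector = scaleC + ab_group_add +
  assumes scaleC_add_right: "a *\<^sub>C (x + y) = a *\<^sub>C x + a *\<^sub>C y"
    and scaleC_add_left: "(a + b) *\<^sub>C x = a *\<^sub>C x + b *\<^sub>C x"
    and scaleC_scaleC: "a *\<^sub>C (b *\<^sub>C x) = (a * b) *\<^sub>C x"
    and scaleC_one: "1 *\<^sub>C x = x"

class complex_normed_vector = complex_vector + real_normed_vector +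
  assumes norm_scaleC: "norm (a *\<^sub>C x) = cmod a * norm x"

class cbanach = complex_normed_vector + complete_space

subclass (in cbanach) banach ..

global_interpretation complex_vector:
  vector_space "scaleC :: complex \<Rightarrow> 'a \<Rightarrow> 'a::complex_vector"
  defines cspan = "module.span (scaleC :: complex \<Rightarrow> 'a \<Rightarrow> 'a)"
  by unfold_locales
     (simp_all add: scaleC_add_right scaleC_add_left scaleC_scaleC scaleC_one)

definition infinite_dimensional :: "'a::complex_vector itself \<Rightarrow> bool" where
  "infinite_dimensional (_ :: 'a itself) \<longleftrightarrow>
     \<not> (\<exists>B :: 'a set. finite B \<and> cspan B = UNIV)"

definition bounded_clinear ::
    "('a::complex_normed_vector \<Rightarrow> 'b::complex_normed_vector) \<Rightarrow> bool" where
  "bounded_clinear f \<longleftrightarrow> bounded_linear f \<and> (\<forall>c x. f (c *\<^sub>C x) = c *\<^sub>C f x)"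

definition is_cnorm :: "('a::complex_vector \<Rightarrow> real) \<Rightarrow> bool" where
  "is_cnorm N \<longleftrightarrow>
     (\<forall>x. 0 \<le> N x) \<and>
     (\<forall>x. N x = 0 \<longleftrightarrow> x = 0) \<and>
     (\<forall>x y. N (x + y) \<le> N x + N y) \<and>
     (\<forall>c x. N (c *\<^sub>C x) = cmod c * N x)"

definition equivalent_norm :: "('a::complex_normed_vector \<Rightarrow> real) \<Rightarrow> bool" where
  "equivalent_norm N \<longleftrightarrow>
     is_cnorm N \<and>
     (\<exists>a>0. \<exists>b>0. \<forall>x. a * norm x \<le> N x \<and> N x \<le> b * norm x)"

text \<open>
  Operator norm with respect to an arbitrary norm \<open>N\<close>, following the definition of
  \<^const>\<open>onorm\<close> (in particular \<open>N (f 0) / N 0 = 0\<close>). The set is bounded above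
  whenever \<open>N\<close> is an equivalent norm and \<open>f\<close> is bounded.
\<close>

definition onorm_wrt :: "('a::complex_vector \<Rightarrow> real) \<Rightarrow> ('a \<Rightarrow> 'a) \<Rightarrow> real" where
  "onorm_wrt N f = (SUP x. N (f x) / N x)"

lemma onorm_wrt_norm: "onorm_wrt norm f = onorm f"
  by (simp add: onorm_wrt_def onorm_def)

end

theory Submission
  imports Defs
begin

text \<open>
  The operator has the form \<open>T = I - (\<Sum>j. r\<^sub>j P\<^sub>j)\<close> with mutually annihilating rank-one
  projections \<open>P\<^sub>j\<close>, uniformly bounded in norm, and rates \<open>r\<^sub>j\<close> that decrease to \<open>0\<close> extremely
  fast. Such an operator multiplies the range of \<open>P\<^sub>j\<close> by \<open>1 - r\<^sub>j\<close>, so that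
  \<open>T\<^sup>n - T\<^sup>n\<^sup>+\<^sup>1 = (\<Sum>j. r\<^sub>j (1 - r\<^sub>j)\<^sup>n P\<^sub>j)\<close> and \<open>I - T\<^sup>n = (\<Sum>j. (1 - (1 - r\<^sub>j)\<^sup>n) P\<^sub>j)\<close>.

  Differences. The number \<open>n r (1 - r)\<^sup>n\<close> is at most \<open>s exp (- s)\<close> with \<open>s = n r\<close>. This function
  of \<open>s\<close> has maximum \<open>1/e\<close> and is small unless \<open>s\<close> is of moderate size. As the ratios of
  consecutive rates tend to infinity, \<open>n r\<^sub>j\<close> is of moderate size for at most one \<open>j\<close>, and the
  coefficients of \<open>n (T\<^sup>n - T\<^sup>n\<^sup>+\<^sup>1)\<close> add up to at most \<open>1/e + o(1)\<close>
  (\<open>suminf_step_weight_le\<close>). Hence \<open>n\<close> times the norm of the difference is bounded, and its upper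
  limit is at most \<open>1/e\<close> in every norm in which all \<open>P\<^sub>j\<close> are contractions. The norm
  \<open>max (norm x) (SUP j. norm (P\<^sub>j x))\<close> is one, and it is equivalent because the \<open>P\<^sub>j\<close> are
  uniformly bounded.

  Growth. For fixed \<open>j\<close> the coefficient \<open>1 - (1 - r\<^sub>j)\<^sup>n\<close> tends to \<open>1\<close>, so \<open>T\<^sup>n\<close> behaves like
  \<open>I\<close> minus a partial sum of the \<open>P\<^sub>j\<close>. The partial sums are unbounded as soon as some functional
  \<open>\<phi>\<close> and vector \<open>b\<close> satisfy \<open>\<phi> (P\<^sub>j b) = 1\<close> for all \<open>j\<close>. To achieve this, take a
  biorthogonal sequence of vectors \<open>u\<^sub>i\<close> and functionals \<open>f\<^sub>i\<close>, both uniformly bounded, and put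
  \<open>P\<^sub>j x = (f\<^sub>j x + f\<^sub>b x) (u\<^sub>j + u\<^sub>a)\<close>, where two indices \<open>a\<close> and \<open>b\<close> are reserved. All
  \<open>P\<^sub>j\<close> share the piece that maps \<open>u\<^sub>b\<close> to \<open>u\<^sub>a\<close>; it is invisible in the compositions
  \<open>P\<^sub>i P\<^sub>j\<close>, but these pieces add up in the sum of the \<open>P\<^sub>j\<close>.

  The biorthogonal sequence (\<open>exists_biorthogonal_sequence\<close>) is the only place where infinite
  dimension enters. It comes from Mazur's construction of basic sequences, for which the
  Hahn--Banach theorem is derived first.
\<close>

section \<open>Hahn--Banach by minimal sublinear functionals\<close>

definition sublinear :: "('a::real_vector \<Rightarrow> real) \<Rightarrow> bool" where
  "sublinear p \<longleftrightarrow>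
     (\<forall>x y. p (x + y) \<le> p x + p y) \<and> (\<forall>c x. 0 < c \<longrightarrow> p (c *\<^sub>R x) \<le> c * p x)"

text \<open>
  Scaling the zero vector by \<open>2\<close> and by \<open>1/2\<close> bounds \<open>p 0\<close> from both sides: the one-sided
  homogeneity in the definition already forces equality.
\<close>

lemma sublinear_zero:
  assumes "sublinear p" shows "p 0 = 0"
proof -
  have "p ((1/2) *\<^sub>R 0) \<le> (1/2) * p 0" "p (2 *\<^sub>R 0) \<le> 2 * p 0"
    using assms unfolding sublinear_def by (metis half_gt_zero zero_less_one, metis zero_less_numeral)
  then show ?thesis by simp
qed

lemma sublinear_scaleR:
  assumes "sublinear p" "0 \<le> c" shows "p (c *\<^sub>R x) = c * p x"
proof (cases "c = 0")
  case True
  then show ?thesis using sublinear_zero[OF assms(1)] by simp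
next
  case False
  then have c: "0 < c" using assms(2) by simp
  then have "p (inverse c *\<^sub>R c *\<^sub>R x) \<le> inverse c * p (c *\<^sub>R x)"
    using assms(1) unfolding sublinear_def by (meson positive_imp_inverse_positive)
  then have "c * p x \<le> p (c *\<^sub>R x)" using c by (simp add: field_simps)
  moreover have "p (c *\<^sub>R x) \<le> c * p x" using assms(1) c unfolding sublinear_def by blast
  ultimately show ?thesis by simp
qed

lemma sublinear_add: "sublinear p \<Longrightarrow> p (x + y) \<le> p x + p y"
  unfolding sublinear_def by blast

lemma sublinear_ge_uminus:
  assumes "sublinear p" shows "- p (- x) \<le> p x"
  using sublinear_add[OF assms, of x "- x"] sublinear_zero[OF assms] by simp

text \<open>
  This criterion covers the infima formed below: of a chain of functionals, along a ray, and of
  distances to a subspace. In each case the index \<open>k\<close> for the new argument can be written down: the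
  smaller of two functionals, or the sum or the multiple of the given parameters.
\<close>

lemma sublinear_INF:
  fixes g :: "'i \<Rightarrow> 'a::real_vector \<Rightarrow> real"
  assumes ne: "I \<noteq> {}"
    and bdd: "\<And>x. bdd_below ((\<lambda>i. g i x) ` I)"
    and add: "\<And>i j x y. i \<in> I \<Longrightarrow> j \<in> I \<Longrightarrow> \<exists>k\<in>I. g k (x + y) \<le> g i x + g j y"
    and scale: "\<And>i c x. i \<in> I \<Longrightarrow> 0 < c \<Longrightarrow> \<exists>k\<in>I. g k (c *\<^sub>R x) \<le> c * g i x"
  shows "sublinear (\<lambda>x. INF i\<in>I. g i x)"
  unfolding sublinear_def
proof (intro conjI allI impI)
  let ?q = "\<lambda>x. INF i\<in>I. g i x"
  have lower: "?q x \<le> g k x" if "k \<in> I" for k x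
    using that bdd by (intro cINF_lower) auto
  fix x y :: 'a
  have "?q (x + y) - g j y \<le> ?q x" if j: "j \<in> I" for j
  proof (intro cINF_greatest ne)
    fix i assume "i \<in> I"
    with add[OF this j, of x y] lower[of _ "x + y"] show "?q (x + y) - g j y \<le> g i x"
      by fastforce
  qed
  then have "?q (x + y) - ?q x \<le> ?q y"
    by (intro cINF_greatest ne) (simp add: algebra_simps)
  then show "?q (x + y) \<le> ?q x + ?q y" by simp
next
  let ?q = "\<lambda>x. INF i\<in>I. g i x"
  fix c :: real and x :: 'a assume c: "0 < c"
  have "?q (c *\<^sub>R x) / c \<le> ?q x"
  proof (intro cINF_greatest ne)
    fix i assume "i \<in> I"
    then obtain k where "k \<in> I" "g k (c *\<^sub>R x) \<le> c * g i x" using scale c by blast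
    moreover have "?q (c *\<^sub>R x) \<le> g k (c *\<^sub>R x)"
      using \<open>k \<in> I\<close> bdd by (intro cINF_lower) auto
    ultimately show "?q (c *\<^sub>R x) / c \<le> g i x" using c by (simp add: field_simps)
  qed
  then show "?q (c *\<^sub>R x) \<le> c * ?q x" using c by (simp add: field_simps)
qed

text \<open>
  Lowering \<^term>\<open>p\<close> as far as linearity along the ray through \<^term>\<open>y\<close> permits: the
  result is sublinear, lies below \<^term>\<open>p\<close> and takes the value \<open>- p y\<close> at \<open>- y\<close>. A
  minimal sublinear functional cannot be lowered, which makes it additive.
\<close>

definition tilt :: "('a::real_vector \<Rightarrow> real) \<Rightarrow> 'a \<Rightarrow> 'a \<Rightarrow> real" where
  "tilt p y x = (INF t\<in>{0..}. p (x + t *\<^sub>R y) - t * p y)"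

lemma bdd_below_tilt:
  assumes "sublinear p"
  shows "bdd_below ((\<lambda>t. p (x + t *\<^sub>R y) - t * p y) ` {0..})"
proof (rule bdd_belowI2)
  fix t :: real assume "t \<in> {0..}"
  then show "- p (- x) \<le> p (x + t *\<^sub>R y) - t * p y"
    using sublinear_add[OF assms, of "x + t *\<^sub>R y" "- x"] sublinear_scaleR[OF assms, of t y]
    by simp
qed

lemma tilt_le:
  assumes "sublinear p" "0 \<le> t"
  shows "tilt p y x \<le> p (x + t *\<^sub>R y) - t * p y"
  unfolding tilt_def using assms(2) by (intro cINF_lower bdd_below_tilt[OF assms(1)]) simp

lemma sublinear_tilt:
  assumes p: "sublinear p"
  shows "sublinear (tilt p y)"
proof -
  have "sublinear (\<lambda>x. INF t\<in>{0..}. p (x + t *\<^sub>R y) - t * p y)"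
  proof (rule sublinear_INF)
    fix s t :: real and x z :: 'a assume "s \<in> {0..}" "t \<in> {0..}"
    then show "\<exists>k\<in>{0..}. p (x + z + k *\<^sub>R y) - k * p y
        \<le> (p (x + s *\<^sub>R y) - s * p y) + (p (z + t *\<^sub>R y) - t * p y)"
      using sublinear_add[OF p, of "x + s *\<^sub>R y" "z + t *\<^sub>R y"]
      by (intro bexI[of _ "s + t"]) (simp_all add: algebra_simps)
  next
    fix t c :: real and x :: 'a assume "t \<in> {0..}" "0 < c"
    then show "\<exists>k\<in>{0..}. p (c *\<^sub>R x + k *\<^sub>R y) - k * p y \<le> c * (p (x + t *\<^sub>R y) - t * p y)"
      using sublinear_scaleR[OF p, of c "x + t *\<^sub>R y"]
      by (intro bexI[of _ "c * t"]) (simp_all add: algebra_simps)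
  qed (use bdd_below_tilt[OF p] in auto)
  then show ?thesis by (simp add: tilt_def[abs_def])
qed

text \<open>
  Minimality gives \<open>tilt q y = q\<close>, and the bound at \<open>t = 1\<close> then reads
  \<open>q x \<le> q (x + y) - q y\<close>, the converse of subadditivity.
\<close>

lemma linear_of_minimal_sublinear:
  assumes q: "sublinear q"
    and minimal: "\<And>q'. sublinear q' \<Longrightarrow> q' \<le> q \<Longrightarrow> q' = q"
  shows "linear q"
proof -
  have le: "tilt q y \<le> q" for y
    using tilt_le[OF q, of 0 y] by (intro le_funI) simp
  have add: "q (x + y) = q x + q y" for x y
  proof (rule antisym)
    have "tilt q y x \<le> q (x + 1 *\<^sub>R y) - 1 * q y" by (rule tilt_le[OF q]) simp
    then show "q x + q y \<le> q (x + y)" using minimal[OF sublinear_tilt[OF q] le, of y] by simp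
  qed (rule sublinear_add[OF q])
  have minus: "q (- x) = - q x" for x
    using add[of x "- x"] sublinear_zero[OF q] by simp
  show ?thesis
  proof (rule linearI)
    fix c :: real and x
    show "q (c *\<^sub>R x) = c *\<^sub>R q x"
      using sublinear_scaleR[OF q, of c x] sublinear_scaleR[OF q, of "- c" x] minus[of "c *\<^sub>R x"]
      by (cases "0 \<le> c") auto
  qed (rule add)
qed

text \<open>
  Zorn's lemma applies because every sublinear \<open>q \<le> p\<close> satisfies \<open>q x \<ge> - p (- x)\<close>, so that a
  chain has a pointwise infimum.
\<close>

lemma exists_minimal_sublinear:
  assumes p: "sublinear p"
  shows "\<exists>q. sublinear q \<and> q \<le> p \<and> (\<forall>q'. sublinear q' \<longrightarrow> q' \<le> q \<longrightarrow> q' = q)"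
proof -
  let ?A = "{q. sublinear q \<and> q \<le> p}"
  let ?R = "\<lambda>q q'. q' \<le> q"
  have "\<exists>m\<in>?A. \<forall>a\<in>?A. ?R m a \<longrightarrow> a = m"
  proof (rule predicate_Zorn)
    show "partial_order_on ?A (relation_of ?R ?A)"
      by (rule partial_order_on_relation_ofI) auto
    fix C assume "C \<in> Chains (relation_of ?R ?A)"
    then have CA: "C \<subseteq> ?A" and chain: "\<And>a b. a \<in> C \<Longrightarrow> b \<in> C \<Longrightarrow> a \<le> b \<or> b \<le> a"
      unfolding Chains_def relation_of_def by blast+
    show "\<exists>u\<in>?A. \<forall>a\<in>C. u \<le> a"
    proof (cases "C = {}")
      case True
      then show ?thesis using p by auto
    next
      case ne: False
      have bdd: "bdd_below ((\<lambda>q. q x) ` C)" for x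
      proof (rule bdd_belowI2)
        fix q assume "q \<in> C"
        then have "sublinear q" "q (- x) \<le> p (- x)" using CA by (auto simp: le_fun_def)
        then show "- p (- x) \<le> q x" using sublinear_ge_uminus[of q x] by simp
      qed
      let ?u = "\<lambda>x. INF q\<in>C. q x"
      have lower: "?u \<le> q" if "q \<in> C" for q
        by (intro le_funI cINF_lower bdd that)
      have "sublinear ?u"
      proof (rule sublinear_INF[OF ne bdd])
        fix q q' x y assume q: "q \<in> C" "q' \<in> C"
        \<comment> \<open>of two members of the chain, the smaller one serves for both\<close>
        from chain[OF q] show "\<exists>k\<in>C. k (x + y) \<le> q x + q' y"
        proof
          assume "q \<le> q'"
          moreover have "q (x + y) \<le> q x + q y" using CA q by (auto intro: sublinear_add)
          ultimately show ?thesis using q(1) by (metis add_left_mono le_funD order_trans)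
        next
          assume "q' \<le> q"
          moreover have "q' (x + y) \<le> q' x + q' y" using CA q by (auto intro: sublinear_add)
          ultimately show ?thesis using q(2) by (metis add_right_mono le_funD order_trans)
        qed
      next
        fix q and c :: real and x assume "q \<in> C" "0 < c"
        then show "\<exists>k\<in>C. k (c *\<^sub>R x) \<le> c * q x" using CA unfolding sublinear_def by blast
      qed
      moreover have "?u \<le> p"
      proof -
        obtain q where "q \<in> C" using ne by blast
        then have "q \<le> p" using CA by blast
        with lower[OF \<open>q \<in> C\<close>] show ?thesis by (rule order_trans)
      qed
      ultimately show ?thesis using lower by auto
    qed
  qed
  then obtain q where q: "sublinear q" "q \<le> p"
      and minimal: "\<And>a. sublinear a \<Longrightarrow> a \<le> p \<Longrightarrow> a \<le> q \<Longrightarrow> a = q"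
    by blast
  have "\<forall>q'. sublinear q' \<longrightarrow> q' \<le> q \<longrightarrow> q' = q"
    using minimal order_trans[OF _ q(2)] by simp
  with q show ?thesis by (intro exI[of _ q]) simp
qed

text \<open>
  A minimal functional is taken below \<^term>\<open>tilt p y\<close> rather than below \<^term>\<open>p\<close>: this forces
  \<open>f (- y) \<le> - p y\<close>, hence equality at \<^term>\<open>y\<close>.
\<close>

lemma hahn_banach_sublinear:
  fixes p :: "'a::real_vector \<Rightarrow> real"
  assumes p: "sublinear p"
  shows "\<exists>f. linear f \<and> (\<forall>x. f x \<le> p x) \<and> f y = p y"
proof -
  obtain f where f: "sublinear f" "f \<le> tilt p y"
      and minimal: "\<And>q'. sublinear q' \<Longrightarrow> q' \<le> f \<Longrightarrow> q' = f"
    using exists_minimal_sublinear[OF sublinear_tilt[OF p]] by blast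
  have lin: "linear f" by (rule linear_of_minimal_sublinear[OF f(1) minimal])
  have le: "f x \<le> p x" for x
    using f(2) tilt_le[OF p, of 0 y x] unfolding le_fun_def by (auto intro: order_trans)
  have "f (- y) \<le> - p y"
    using f(2) tilt_le[OF p, of 1 y "- y"] sublinear_zero[OF p]
    unfolding le_fun_def by (auto intro: order_trans)
  then have "p y \<le> f y" by (simp add: linear_neg[OF lin])
  then show ?thesis using lin le[of y] le by force
qed

definition cfunctional :: "('a::complex_normed_vector \<Rightarrow> complex) \<Rightarrow> bool" where
  "cfunctional f \<longleftrightarrow> bounded_linear f \<and> (\<forall>c x. f (c *\<^sub>C x) = c * f x)"

lemma sublinear_infdist:
  fixes M :: "'a::complex_normed_vector set"
  assumes M: "complex_vector.subspace M"
  shows "sublinear (\<lambda>x. infdist x M)"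
proof -
  have ne: "M \<noteq> {}" using complex_vector.subspace_0[OF M] by auto
  have "sublinear (\<lambda>x. INF z\<in>M. dist x z)"
  proof (rule sublinear_INF[OF ne])
    fix u v x y assume "u \<in> M" "v \<in> M"
    then show "\<exists>k\<in>M. dist (x + y) k \<le> dist x u + dist y v"
      by (intro bexI[of _ "u + v"] dist_triangle_add complex_vector.subspace_add[OF M])
  next
    fix u and c :: real and x :: 'a assume "u \<in> M" "0 < c"
    moreover have "c *\<^sub>R u \<in> M"
      using \<open>u \<in> M\<close> by (simp add: scaleR_scaleC complex_vector.subspace_scale[OF M])
    ultimately show "\<exists>k\<in>M. dist (c *\<^sub>R x) k \<le> c * dist x u"
      by (intro bexI[of _ "c *\<^sub>R u"]) (simp_all add: dist_norm scaleR_diff_right[symmetric] del: scaleR_diff_right)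
  qed auto
  then show ?thesis by (simp add: infdist_notempty[OF ne])
qed

lemma infdist_scaleC_le:
  fixes M :: "'a::complex_normed_vector set"
  assumes M: "complex_vector.subspace M" and c: "cmod c = 1"
  shows "infdist (c *\<^sub>C x) M \<le> infdist x M"
proof -
  have ne: "M \<noteq> {}" using complex_vector.subspace_0[OF M] by auto
  have "infdist (c *\<^sub>C x) M \<le> dist x z" if "z \<in> M" for z
  proof -
    have "dist (c *\<^sub>C x) (c *\<^sub>C z) = dist x z"
      using c norm_scaleC[of c "x - z"] complex_vector.scale_right_diff_distrib[of c x z]
      by (simp add: dist_norm)
    moreover have "c *\<^sub>C z \<in> M" by (rule complex_vector.subspace_scale[OF M that])
    ultimately show ?thesis using infdist_le by metis
  qed
  then show ?thesis unfolding infdist_notempty[OF ne, of x] by (intro cINF_greatest ne)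
qed

text \<open>
  The distance to \<^term>\<open>M\<close> is the quotient seminorm. The real functional \<open>f\<close> dominated by it is
  the real part of the complex functional \<open>f x - \<i> f (\<i> x)\<close>, and a rotation making the value at
  \<open>x\<close> real and nonnegative transfers the bound from \<open>f\<close> to the modulus.
\<close>

lemma hahn_banach_infdist:
  fixes M :: "'a::complex_normed_vector set"
  assumes M: "complex_vector.subspace M"
  shows "\<exists>F. cfunctional F \<and> (\<forall>x. cmod (F x) \<le> infdist x M) \<and> F y = of_real (infdist y M)"
proof -
  obtain f where lin: "linear f" and le: "\<And>x. f x \<le> infdist x M" and fy: "f y = infdist y M"
    using hahn_banach_sublinear[OF sublinear_infdist[OF M]] by blast
  define F where "F x = Complex (f x) (- f (\<i> *\<^sub>C x))" for x
  have add: "F (x + z) = F x + F z" for x z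
    by (simp add: F_def complex_eq_iff linear_add[OF lin] scaleC_add_right)
  have ii: "f (\<i> *\<^sub>C \<i> *\<^sub>C x) = - f x" for x
    using scaleR_scaleC[of "-1" x] by (simp add: scaleC_scaleC linear_neg[OF lin])
  have scale: "F (c *\<^sub>C x) = c * F x" for c x
  proof -
    have "c *\<^sub>C x = Re c *\<^sub>R x + Im c *\<^sub>R (\<i> *\<^sub>C x)"
      by (simp add: scaleR_scaleC scaleC_scaleC flip: scaleC_add_left)
         (simp add: complex_eq mult.commute)
    moreover have "\<i> *\<^sub>C (r *\<^sub>R z) = r *\<^sub>R (\<i> *\<^sub>C z)" for r and z :: 'a
      by (simp add: scaleR_scaleC scaleC_scaleC mult.commute)
    ultimately show ?thesis
      by (simp add: F_def complex_eq_iff scaleC_add_right linear_add[OF lin]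
          linear_diff[OF lin] linear_scale[OF lin] ii)
  qed
  have bound: "cmod (F x) \<le> infdist x M" for x
  proof (cases "F x = 0")
    case False
    let ?c = "cnj (F x) / cmod (F x)"
    have c: "cmod ?c = 1" using False by (simp add: norm_divide)
    have "cnj (F x) * F x = of_real (cmod (F x)) ^ 2" using complex_norm_square[of "F x"] by (simp add: mult.commute)
    then have "F (?c *\<^sub>C x) = of_real (cmod (F x))"
      using False by (simp add: scale field_simps power2_eq_square)
    then have "cmod (F x) = f (?c *\<^sub>C x)" by (simp add: F_def complex_eq_iff)
    also have "\<dots> \<le> infdist x M" using le infdist_scaleC_le[OF M c] order_trans by blast
    finally show ?thesis .
  qed (simp add: infdist_nonneg)
  have norm_le: "infdist x M \<le> norm x" for x
    using infdist_le[OF complex_vector.subspace_0[OF M], of x] by simp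
  have "bounded_linear F"
  proof (rule bounded_linear_intro[where K = 1])
    show "F (r *\<^sub>R x) = r *\<^sub>R F x" for r x
      by (simp add: scaleR_scaleC scale scaleR_conv_of_real)
    show "norm (F x) \<le> norm x * 1" for x using order_trans[OF bound norm_le] by simp
  qed (rule add)
  moreover have "F y = of_real (infdist y M)"
  proof -
    have re: "Re (F y) = infdist y M" by (simp add: F_def fy)
    then have "cmod (F y) = \<bar>Re (F y)\<bar>" using bound[of y] abs_Re_le_cmod[of "F y"] by linarith
    then have "Im (F y) = 0" using cmod_power2[of "F y"] by simp
    with re show ?thesis by (simp add: complex_eq_iff)
  qed
  ultimately show ?thesis
    using scale bound unfolding cfunctional_def by (intro exI[of _ F]) simp
qed

section \<open>Bounded biorthogonal sequences\<close>

lemma bounded_linear_scaleC_left: "bounded_linear (\<lambda>c. c *\<^sub>C (v :: 'a::complex_normed_vector))"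
  by (rule bounded_linear_intro[where K = "norm v"])
     (simp_all add: scaleC_add_left scaleR_scaleC scaleC_scaleC scaleR_conv_of_real norm_scaleC)

lemma bounded_linear_scaleC_right: "bounded_linear (\<lambda>v :: 'a::complex_normed_vector. c *\<^sub>C v)"
  by (rule bounded_linear_intro[where K = "cmod c"])
     (simp_all add: scaleC_add_right scaleR_scaleC scaleC_scaleC norm_scaleC mult.commute)

lemma cfunctional_linear: "cfunctional f \<Longrightarrow> linear f"
  unfolding cfunctional_def by (blast intro: bounded_linear.linear)

lemma cfunctional_scaleC: "cfunctional f \<Longrightarrow> f (c *\<^sub>C x) = c * f x"
  unfolding cfunctional_def by blast

text \<open>
  The common kernel of finitely many functionals has finite codimension: each functional that does
  not vanish on the common kernel of the previous ones costs one additional dimension.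
\<close>

lemma exists_cspan_agreeing_on_functionals:
  fixes G :: "('a::complex_normed_vector \<Rightarrow> complex) set"
  assumes "finite G" "\<forall>g\<in>G. cfunctional g"
  shows "\<exists>B. finite B \<and> (\<forall>x. \<exists>z\<in>cspan B. \<forall>g\<in>G. g (x - z) = 0)"
  using assms
proof (induction G rule: finite_induct)
  case empty
  then show ?case by (intro exI[of _ "{}"]) (auto intro: complex_vector.span_zero)
next
  case (insert h G)
  then have "\<exists>B. finite B \<and> (\<forall>x. \<exists>z\<in>cspan B. \<forall>g\<in>G. g (x - z) = 0)" by simp
  then obtain B where B: "finite B" "\<And>x. \<exists>z\<in>cspan B. \<forall>g\<in>G. g (x - z) = 0" by (elim exE conjE) simp
  have h: "cfunctional h" using insert.prems by simp
  show ?case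
  proof (cases "\<forall>w. (\<forall>g\<in>G. g w = 0) \<longrightarrow> h w = 0")
    case True
    then have "\<exists>z\<in>cspan B. \<forall>g\<in>insert h G. g (x - z) = 0" for x
    proof -
      obtain z where "z \<in> cspan B" "\<forall>g\<in>G. g (x - z) = 0" using B(2)[of x] by (elim bexE)
      then show ?thesis using True by (intro bexI[of _ z]) simp_all
    qed
    then show ?thesis using B(1) by (intro exI[of _ B]) simp
  next
    case False
    then obtain w where w: "\<And>g. g \<in> G \<Longrightarrow> g w = 0" "h w \<noteq> 0" by auto
    have "\<exists>z\<in>cspan (insert w B). \<forall>g\<in>insert h G. g (x - z) = 0" for x
    proof -
      obtain z where z: "z \<in> cspan B" "\<forall>g\<in>G. g (x - z) = 0" using B(2) by blast
      let ?z = "z + (h (x - z) / h w) *\<^sub>C w"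
      have "?z \<in> cspan (insert w B)"
      proof (intro complex_vector.span_add complex_vector.span_scale)
        show "z \<in> cspan (insert w B)"
          using z(1) complex_vector.span_mono[OF subset_insertI] by (rule rev_subsetD)
        show "w \<in> cspan (insert w B)" by (intro complex_vector.span_base insertI1)
      qed
      moreover have eq: "g (x - ?z) = g (x - z) - (h (x - z) / h w) * g w" if "cfunctional g" for g
        unfolding diff_diff_eq[symmetric] linear_diff[OF cfunctional_linear[OF that]]
          cfunctional_scaleC[OF that] ..
      have "g (x - ?z) = 0" if "g \<in> insert h G" for g
        using that z(2) w insert.prems eq[of g] w(1)[of g]
        by (cases "g = h") auto
      ultimately show ?thesis by (intro bexI[of _ ?z]) simp_all
    qed
    then show ?thesis using B(1) by (intro exI[of _ "insert w B"]) simp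
  qed
qed

lemma exists_unit_vector_in_kernels:
  fixes G :: "('a::complex_normed_vector \<Rightarrow> complex) set"
  assumes inf: "infinite_dimensional TYPE('a)" and G: "finite G" "\<forall>g\<in>G. cfunctional g"
  shows "\<exists>v. norm v = 1 \<and> (\<forall>g\<in>G. g v = 0)"
proof -
  obtain B where B: "finite B" "\<And>x. \<exists>z\<in>cspan B. \<forall>g\<in>G. g (x - z) = 0"
    using exists_cspan_agreeing_on_functionals[OF G] by blast
  obtain x where "x \<notin> cspan B" using inf B(1) unfolding infinite_dimensional_def by blast
  obtain z where "z \<in> cspan B" "\<forall>g\<in>G. g (x - z) = 0" using B(2) by blast
  moreover from this \<open>x \<notin> cspan B\<close> have "x - z \<noteq> 0" by auto
  ultimately obtain w where w: "w \<noteq> 0" "\<forall>g\<in>G. g w = 0" by blast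
  have "\<forall>g\<in>G. g (w /\<^sub>R norm w) = 0"
    using w(2) G(2) by (simp add: linear_scale[OF cfunctional_linear])
  moreover have "norm (w /\<^sub>R norm w) = 1" using w(1) by simp
  ultimately show ?thesis by blast
qed

lemma compact_bounded_combinations:
  fixes u :: "nat \<Rightarrow> 'a::complex_normed_vector"
  shows "compact {\<Sum>i<n. c i *\<^sub>C u i | c. \<forall>i<n. cmod (c i) \<le> R}" (is "compact (?K n)")
proof (induction n)
  case 0
  then show ?case by simp
next
  case (Suc n)
  let ?L = "(\<lambda>c. c *\<^sub>C u n) ` cball 0 R"
  have "compact ?L"
    by (intro compact_continuous_image bounded_linear.continuous_on[OF bounded_linear_scaleC_left])
       (auto intro: continuous_intros)
  then have "compact {x + y | x y. x \<in> ?K n \<and> y \<in> ?L}" by (rule compact_sums[OF Suc])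
  moreover have "{x + y | x y. x \<in> ?K n \<and> y \<in> ?L} = ?K (Suc n)"
  proof (intro equalityI subsetI)
    fix z assume "z \<in> {x + y | x y. x \<in> ?K n \<and> y \<in> ?L}"
    then obtain c d where c: "z = (\<Sum>i<n. c i *\<^sub>C u i) + d *\<^sub>C u n"
        "\<forall>i<n. cmod (c i) \<le> R" "cmod d \<le> R"
      by auto
    have "(\<Sum>i<Suc n. (c(n := d)) i *\<^sub>C u i) = z" by (simp add: c(1))
    moreover have "\<forall>i<Suc n. cmod ((c(n := d)) i) \<le> R" using c by (simp add: less_Suc_eq)
    ultimately show "z \<in> ?K (Suc n)" by blast
  next
    fix z assume "z \<in> ?K (Suc n)"
    then obtain c where "z = (\<Sum>i<Suc n. c i *\<^sub>C u i)" "\<forall>i<Suc n. cmod (c i) \<le> R" by blast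
    then have "z = (\<Sum>i<n. c i *\<^sub>C u i) + c n *\<^sub>C u n" "(\<Sum>i<n. c i *\<^sub>C u i) \<in> ?K n"
        "c n *\<^sub>C u n \<in> ?L"
      by auto
    then show "z \<in> {x + y | x y. x \<in> ?K n \<and> y \<in> ?L}" by blast
  qed
  ultimately show ?case by simp
qed

text \<open>
  This is Mazur's step. Let \<open>M\<close> be the span of the given vectors. Its bounded part is compact, so
  finitely many functionals almost attain the norm of every point of that part. A unit vector
  \<open>v\<close> killed by them and by the given \<open>f\<^sub>i\<close> stays away from \<open>M\<close>: these functionals do not see
  \<open>v\<close>, so \<open>dist v z\<close> is at least almost \<open>norm z\<close>, while it is also at least \<open>1 - norm z\<close>. Hence the
  distance of \<open>v\<close> from \<open>M\<close> is at least \<open>1/4\<close>, and Hahn--Banach gives a functional that vanishes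
  on \<open>M\<close>, is \<open>1\<close> at \<open>v\<close> and has norm at most \<open>4\<close>. As this bound does not depend on the bounds
  for the given \<open>f\<^sub>i\<close>, it does not deteriorate when the step is iterated.
\<close>

lemma biorthogonal_extension:
  fixes u :: "nat \<Rightarrow> 'a::complex_normed_vector" and f :: "nat \<Rightarrow> 'a \<Rightarrow> complex"
  assumes inf: "infinite_dimensional TYPE('a)"
    and f: "\<And>i. i < n \<Longrightarrow> cfunctional (f i)" "\<And>i x. i < n \<Longrightarrow> cmod (f i x) \<le> 4 * norm x"
    and fu: "\<And>i j. i < n \<Longrightarrow> j < n \<Longrightarrow> f i (u j) = of_bool (i = j)"
  shows "\<exists>v g. norm v = 1 \<and> cfunctional g \<and> (\<forall>x. cmod (g x) \<le> 4 * norm x) \<and> g v = 1 \<and>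
           (\<forall>i<n. f i v = 0 \<and> g (u i) = 0)"
proof -
  define M where "M = range (\<lambda>c. \<Sum>i<n. c i *\<^sub>C u i)"
  have M: "complex_vector.subspace M"
    unfolding complex_vector.subspace_def
  proof (intro conjI ballI allI)
    show "0 \<in> M" unfolding M_def by (rule range_eqI[of _ _ "\<lambda>_. 0"]) simp
  next
    fix x y assume "x \<in> M" "y \<in> M"
    then obtain c d where "x = (\<Sum>i<n. c i *\<^sub>C u i)" "y = (\<Sum>i<n. d i *\<^sub>C u i)"
      unfolding M_def by blast
    then show "x + y \<in> M" unfolding M_def
      by (intro range_eqI[of _ _ "\<lambda>i. c i + d i"]) (simp add: scaleC_add_left sum.distrib)
  next
    fix a x assume "x \<in> M"
    then obtain c where "x = (\<Sum>i<n. c i *\<^sub>C u i)" unfolding M_def by blast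
    then show "a *\<^sub>C x \<in> M" unfolding M_def
      by (intro range_eqI[of _ _ "\<lambda>i. a * c i"])
         (simp add: complex_vector.scale_sum_right scaleC_scaleC)
  qed
  have u_in: "u i \<in> M" if "i < n" for i
    unfolding M_def using that
    by (intro range_eqI[of _ _ "\<lambda>j. of_bool (j = i)"])
       (simp add: of_bool_def if_distrib[of "\<lambda>c. c *\<^sub>C _"] cong: if_cong)
  \<comment> \<open>the coefficients of \<open>z \<in> M\<close> are the numbers \<open>f\<^sub>i z\<close>, of modulus at most
    \<open>4 * norm z \<le> 8\<close> if \<open>norm z \<le> 2\<close>; points with \<open>norm z > 2\<close> are far from unit vectors anyway\<close>
  define K where "K = {\<Sum>i<n. c i *\<^sub>C u i | c. \<forall>i<n. cmod (c i) \<le> 8}"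
  have in_K: "z \<in> K" if z: "z \<in> M" "norm z \<le> 2" for z
  proof -
    obtain c where c: "z = (\<Sum>i<n. c i *\<^sub>C u i)" using z(1) unfolding M_def by blast
    have "cmod (c i) \<le> 8" if "i < n" for i
    proof -
      have "f i z = (\<Sum>j<n. c j * of_bool (i = j))"
        unfolding c linear_sum[OF cfunctional_linear[OF f(1)[OF that]]]
        using that by (intro sum.cong) (simp_all add: cfunctional_scaleC f fu)
      also have "\<dots> = c i" using that by (simp add: of_bool_def if_distrib cong: if_cong)
      finally show ?thesis using f(2)[OF that, of z] z(2) by simp
    qed
    then show ?thesis using c unfolding K_def by blast
  qed
  have "compact K" unfolding K_def by (rule compact_bounded_combinations)
  then obtain net where net: "finite net" "K \<subseteq> (\<Union>z\<in>net. ball z (1/8))"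
    unfolding compact_eq_totally_bounded by (metis zero_less_divide_1_iff zero_less_numeral)
  have "\<exists>F. cfunctional F \<and> (\<forall>x. cmod (F x) \<le> norm x) \<and> F z = of_real (norm z)" for z :: 'a
    using hahn_banach_infdist[OF complex_vector.subspace_single_0, of z]
    by (simp add: infdist_singleton)
  then obtain F where F: "\<And>z. cfunctional (F z)" "\<And>z x :: 'a. cmod (F z x) \<le> norm x"
      "\<And>z. F z z = of_real (norm z)"
    by metis
  obtain v where v: "norm v = 1" "\<And>i. i < n \<Longrightarrow> f i v = 0" "\<And>z. z \<in> net \<Longrightarrow> F z v = 0"
  proof -
    have "\<exists>v. norm v = 1 \<and> (\<forall>g \<in> f ` {..<n} \<union> F ` net. g v = 0)"
      using net(1) f(1) F(1) by (intro exists_unit_vector_in_kernels[OF inf]) auto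
    then show thesis using that by blast
  qed
  have dist: "1/4 \<le> dist v z" if z: "z \<in> M" for z
  proof (cases "norm z \<le> 2")
    case True
    then obtain z0 where z0: "z0 \<in> net" "norm (z0 - z) < 1/8"
      using in_K[OF z] net(2) by (auto simp: dist_norm)
    have "F z0 z0 = F z0 (z0 - z) - F z0 (v - z)"
      using v(3)[OF z0(1)] by (simp add: linear_diff[OF cfunctional_linear[OF F(1)]])
    then have "norm z0 \<le> cmod (F z0 (z0 - z)) + cmod (F z0 (v - z))"
      using norm_triangle_ineq4[of "F z0 (z0 - z)" "F z0 (v - z)"] F(3)[of z0]
      by (metis norm_of_real abs_norm_cancel)
    then have "norm z0 \<le> norm (z0 - z) + norm (v - z)"
      using F(2)[of z0 "z0 - z"] F(2)[of z0 "v - z"] by linarith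
    then show ?thesis
      using z0(2) v(1) norm_triangle_ineq2[of v z] norm_triangle_ineq2[of z z0]
      unfolding dist_norm norm_minus_commute[of z z0] by linarith
  next
    case False
    then show ?thesis using v(1) norm_triangle_ineq2[of z v] unfolding dist_norm norm_minus_commute[of z v]
      by linarith
  qed
  define d where "d = infdist v M"
  have ne: "M \<noteq> {}" using complex_vector.subspace_0[OF M] by auto
  have d: "1/4 \<le> d" unfolding d_def infdist_notempty[OF ne] by (intro cINF_greatest ne dist)
  obtain H where H: "cfunctional H" "\<And>x. cmod (H x) \<le> infdist x M" "H v = of_real d"
    using hahn_banach_infdist[OF M, of v] unfolding d_def by blast
  let ?g = "\<lambda>x. H x / of_real d"
  have "cfunctional ?g"
    using H(1) bounded_linear_compose[OF bounded_linear_divide, of H] unfolding cfunctional_def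
    by simp
  moreover have "cmod (?g x) \<le> 4 * norm x" for x
  proof -
    have "cmod (H x) \<le> norm x"
      using H(2)[of x] infdist_le[OF complex_vector.subspace_0[OF M], of x] by simp
    also have "\<dots> \<le> 4 * norm x * d" using mult_left_mono[OF d, of "4 * norm x"] by simp
    finally show ?thesis using d by (simp add: norm_divide field_simps)
  qed
  moreover have "?g (u i) = 0" if "i < n" for i
    using H(2)[of "u i"] u_in[OF that] by simp
  moreover have "?g v = 1" using H(3) d by simp
  ultimately show ?thesis using v(1,2) by (intro exI[of _ v] exI[of _ ?g]) blast
qed

lemma exists_biorthogonal_sequence:
  assumes inf: "infinite_dimensional TYPE('a::complex_normed_vector)"
  shows "\<exists>(u :: nat \<Rightarrow> 'a) f. (\<forall>n. norm (u n) = 1) \<and> (\<forall>n. cfunctional (f n)) \<and>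
           (\<forall>n x. cmod (f n x) \<le> 4 * norm x) \<and> (\<forall>m n. f m (u n) = of_bool (m = n))"
proof -
  define good where "good s n r \<longleftrightarrow>
      norm (fst r) = 1 \<and> cfunctional (snd r) \<and> (\<forall>x. cmod (snd r x) \<le> 4 * norm x) \<and>
      snd r (fst r) = 1 \<and> (\<forall>i<n. snd (s i) (fst r) = 0 \<and> snd r (fst (s i)) = 0)"
    for s :: "nat \<Rightarrow> 'a \<times> ('a \<Rightarrow> complex)" and n r
  have biorthogonal: "snd (s i) (fst (s j)) = of_bool (i = j)"
    if "good s i (s i)" "good s j (s j)" for s i j
    using that unfolding good_def by (cases i j rule: linorder_cases) simp_all
  have "\<exists>s. \<forall>n. good s n (s n)"
  proof (rule dependent_wf_choice[OF wf_less, of good])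
    fix s t :: "nat \<Rightarrow> 'a \<times> ('a \<Rightarrow> complex)" and n r
    assume "\<And>m. (m, n) \<in> {(x, y). x < y} \<Longrightarrow> s m = t m"
    then show "good s n r = good t n r" unfolding good_def by simp
  next
    fix n and s :: "nat \<Rightarrow> 'a \<times> ('a \<Rightarrow> complex)"
    assume "\<And>m. (m, n) \<in> {(x, y). x < y} \<Longrightarrow> good s m (s m)"
    then have prev: "good s i (s i)" if "i < n" for i using that by simp
    have "\<exists>v g. norm v = 1 \<and> cfunctional g \<and> (\<forall>x. cmod (g x) \<le> 4 * norm x) \<and> g v = 1 \<and>
        (\<forall>i<n. snd (s i) v = 0 \<and> g (fst (s i)) = 0)"
    proof (rule biorthogonal_extension[OF inf])
      fix i j assume "i < n" "j < n"
      then show "snd (s i) (fst (s j)) = of_bool (i = j)" by (intro biorthogonal prev)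
    qed (use prev in \<open>auto simp: good_def\<close>)
    then obtain v g where "good s n (v, g)" unfolding good_def fst_conv snd_conv by (elim exE)
    then show "\<exists>r. good s n r" by (rule exI)
  qed
  then obtain s where s: "\<And>n. good s n (s n)" by blast
  have "snd (s i) (fst (s j)) = of_bool (i = j)" for i j by (intro biorthogonal s)
  then show ?thesis
    using s unfolding good_def
    by (intro exI[of _ "\<lambda>n. fst (s n)"] exI[of _ "\<lambda>n. snd (s n)"]) simp
qed

section \<open>Rapidly decreasing rates\<close>

text \<open>
  The geometric mean of \<open>rate k\<close> and \<open>rate (k + 1)\<close> is \<open>1 / 2 ^ (2 * k\<^sup>2 + 2 * k + 1)\<close>. Thus
  \<open>level n\<close> is the first index at which \<open>n\<close> times this mean drops below \<open>1\<close>. With \<open>k = level n\<close>,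
  the products \<open>n * rate j\<close> are large for \<open>j < k\<close> and small for \<open>j > k\<close>; only \<open>j = k\<close> can make
  a term near the maximum \<open>1/e\<close>.
\<close>

definition rate :: "nat \<Rightarrow> real" where
  "rate j = 1 / 2 ^ (2 * j\<^sup>2)"

definition step_weight :: "nat \<Rightarrow> nat \<Rightarrow> real" where
  "step_weight n j = rate j * (1 - rate j) ^ n"

definition level :: "nat \<Rightarrow> nat" where
  "level n = (LEAST k. n < 2 ^ (2 * k\<^sup>2 + 2 * k + 1))"

lemma rate_pos: "0 < rate j" and rate_le_1: "rate j \<le> 1"
  unfolding rate_def by (simp_all add: divide_le_eq_1)

lemma step_weight_nonneg: "0 \<le> step_weight n j"
  unfolding step_weight_def using rate_pos[of j] rate_le_1[of j] by simp

lemma step_weight_le_exp: "real n * step_weight n j \<le> (n * rate j) * exp (- (n * rate j))"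
proof -
  have "(1 - rate j) ^ n \<le> exp (- rate j) ^ n"
    using rate_le_1[of j] exp_ge_add_one_self[of "- rate j"] by (intro power_mono) simp_all
  also have "\<dots> = exp (- (n * rate j))" by (simp flip: exp_of_nat_mult)
  finally show ?thesis
    unfolding step_weight_def using rate_pos[of j] by (simp add: mult_left_mono mult.assoc)
qed

lemma mult_exp_uminus_le:
  fixes s :: real assumes s: "0 < s"
  shows "s * exp (- s) \<le> 1 / exp 1" "s * exp (- s) \<le> s" "s * exp (- s) \<le> 2 / s"
proof -
  have "s \<le> exp (s - 1)" using exp_ge_add_one_self[of "s - 1"] by simp
  then show "s * exp (- s) \<le> 1 / exp 1" by (simp add: exp_minus exp_diff field_simps)
  show "s * exp (- s) \<le> s" using s by simp
  have "s\<^sup>2 / 2 \<le> exp s" using exp_lower_Taylor_quadratic[of s] s by simp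
  then show "s * exp (- s) \<le> 2 / s" using s by (simp add: exp_minus field_simps power2_eq_square)
qed

lemma less_level: "n < 2 ^ (2 * (level n)\<^sup>2 + 2 * level n + 1)"
  unfolding level_def
proof (rule LeastI)
  have "n < 2 ^ n" by (rule less_exp)
  also have "(2::nat) ^ n \<le> 2 ^ (2 * n\<^sup>2 + 2 * n + 1)" by (intro power_increasing) simp_all
  finally show "n < 2 ^ (2 * n\<^sup>2 + 2 * n + 1)" .
qed

lemma le_of_less_level: "k < level n \<Longrightarrow> 2 ^ (2 * k\<^sup>2 + 2 * k + 1) \<le> n"
  unfolding level_def using not_less_Least by (metis not_less)

lemma filterlim_level: "filterlim level at_top sequentially"
  unfolding filterlim_at_top
proof
  fix K
  show "\<forall>\<^sub>F n in sequentially. K \<le> level n"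
    using eventually_ge_at_top[of "2 ^ (2 * K\<^sup>2 + 2 * K + 1)"]
  proof eventually_elim
    case (elim n)
    show ?case
    proof (rule ccontr)
      assume "\<not> K \<le> level n"
      then have "2 * (level n)\<^sup>2 + 2 * level n + 1 \<le> 2 * K\<^sup>2 + 2 * K + 1"
        by (intro add_mono mult_left_mono power_mono) simp_all
      then have "(2::nat) ^ (2 * (level n)\<^sup>2 + 2 * level n + 1) \<le> 2 ^ (2 * K\<^sup>2 + 2 * K + 1)"
        by (intro power_increasing) simp_all
      then show False using less_level[of n] elim by linarith
    qed
  qed
qed

text \<open>
  For \<open>j > level n\<close> the inequality that defines the level gives an upper bound for
  \<open>s = n * rate j\<close>, and \<open>s exp (- s) \<le> s\<close> applies; for \<open>j < level n\<close> the minimality of the level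
  gives a lower bound for \<open>s\<close>, and \<open>s exp (- s) \<le> 2 / s\<close> applies. The exponents of \<open>2\<close> are
  quadratic in the index, and the two that are compared differ by at least \<open>j + level n\<close>, which
  makes the error summable over \<open>j\<close> and small in \<open>n\<close> at once.
\<close>

lemma step_weight_off_level:
  assumes "j \<noteq> level n" "0 < n"
  shows "real n * step_weight n j \<le> 2 * (1/2) ^ level n * (1/2) ^ j"
proof -
  define k where "k = level n"
  define s where "s = real n * rate j"
  have s: "0 < s" unfolding s_def using assms(2) rate_pos[of j] by simp
  have "s * exp (- s) \<le> 2 * (1/2) ^ (j + k)"
  proof (cases "k < j")
    case True
    then obtain d where d: "j = Suc (k + d)" using less_imp_Suc_add by blast
    have "(2 * k\<^sup>2 + 2 * k + 1) + (j + k) \<le> 2 * j\<^sup>2"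
      unfolding d by (simp add: power2_eq_square algebra_simps)
    then have "(2::real) ^ ((2 * k\<^sup>2 + 2 * k + 1) + (j + k)) \<le> 2 ^ (2 * j\<^sup>2)"
      by (intro power_increasing) simp_all
    moreover have "real n \<le> 2 ^ (2 * k\<^sup>2 + 2 * k + 1)"
    proof -
      have "real n < real (2 ^ (2 * k\<^sup>2 + 2 * k + 1))"
        using less_level[of n] unfolding k_def of_nat_less_iff .
      then show ?thesis by simp
    qed
    ultimately have "real n * 2 ^ (j + k) \<le> 2 ^ (2 * j\<^sup>2)"
      unfolding power_add[of _ _ "j + k"]
      by (rule order_trans[OF mult_right_mono, rotated 2]) simp_all
    then have "s \<le> (1/2) ^ (j + k)" unfolding s_def rate_def by (simp add: field_simps)
    also have "\<dots> \<le> 2 * (1/2) ^ (j + k)" by simp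
    finally show ?thesis using mult_exp_uminus_le(2)[OF s] by linarith
  next
    case False
    then have "j < k" using assms(1) unfolding k_def by simp
    then obtain d where d: "k = Suc (j + d)" using less_imp_Suc_add by blast
    have "2 ^ (2 * (j + d)\<^sup>2 + 2 * (j + d) + 1) \<le> n"
      using d unfolding k_def by (intro le_of_less_level) simp
    then have "real (2 ^ (2 * (j + d)\<^sup>2 + 2 * (j + d) + 1)) \<le> real n" by (rule of_nat_mono)
    then have "(2::real) ^ (2 * (j + d)\<^sup>2 + 2 * (j + d) + 1) \<le> real n" by simp
    moreover have "2 * j\<^sup>2 + (j + k) \<le> 2 * (j + d)\<^sup>2 + 2 * (j + d) + 1"
      unfolding d by (simp add: power2_eq_square algebra_simps)
    then have "(2::real) ^ (2 * j\<^sup>2 + (j + k)) \<le> 2 ^ (2 * (j + d)\<^sup>2 + 2 * (j + d) + 1)"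
      by (intro power_increasing) simp_all
    ultimately have "2 ^ (2 * j\<^sup>2) * 2 ^ (j + k) \<le> real n"
      unfolding power_add[of _ _ "j + k"] by (rule order_trans[rotated])
    then have "2 ^ (j + k) \<le> s" unfolding s_def rate_def by (simp add: field_simps)
    then have "2 / s \<le> 2 / 2 ^ (j + k)" by (intro divide_left_mono) (use s in simp_all)
    then show ?thesis using mult_exp_uminus_le(3)[OF s] by (simp add: power_one_over)
  qed
  then show ?thesis
    using step_weight_le_exp[of n j] unfolding s_def k_def by (simp add: power_add mult_ac)
qed

lemma summable_rate: "summable rate"
proof (rule summable_comparison_test')
  show "summable (\<lambda>j. (1/2 :: real) ^ j)" by (simp add: summable_geometric)
  have "(2::real) ^ j \<le> 2 ^ (2 * j\<^sup>2)" for j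
    by (intro power_increasing) (auto simp: power2_eq_square)
  then show "norm (rate j) \<le> (1/2) ^ j" for j
    unfolding rate_def by (simp add: power_one_over frac_le)
qed

lemma summable_step_weight: "summable (step_weight n)"
proof (rule summable_comparison_test'[OF summable_rate])
  show "norm (step_weight n j) \<le> rate j" for j
    using rate_pos[of j] rate_le_1[of j] step_weight_nonneg[of n j]
    unfolding step_weight_def by (simp add: mult_left_le power_le_one)
qed

lemma suminf_step_weight_le:
  "real n * suminf (step_weight n) \<le> 1 / exp 1 + 4 * (1/2) ^ level n"
proof (cases "n = 0")
  case True
  then show ?thesis by (simp add: add_nonneg_nonneg)
next
  case False
  define k where "k = level n"
  define c :: real where "c = 2 * (1/2) ^ k"
  have sums: "(\<lambda>j. real n * step_weight n j) sums (real n * suminf (step_weight n))"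
    by (rule sums_mult[OF summable_sums[OF summable_step_weight]])
  have sums_bound: "(\<lambda>j. (if j = k then 1 / exp 1 else 0) + c * (1/2) ^ j)
      sums (1 / exp 1 + c * (1 / (1 - 1/2)))"
    by (rule sums_add[OF sums_single sums_mult[OF geometric_sums]]) simp
  have "real n * step_weight n j \<le> (if j = k then 1 / exp 1 else 0) + c * (1/2) ^ j" for j
  proof (cases "j = k")
    case True
    have "real n * step_weight n j \<le> 1 / exp 1"
      by (rule order_trans[OF step_weight_le_exp mult_exp_uminus_le(1)])
         (use False rate_pos[of j] in simp)
    moreover have "0 \<le> c * (1/2) ^ j" unfolding c_def by simp
    ultimately show ?thesis using True by simp
  next
    case off: False
    have "real n * step_weight n j \<le> c * (1/2) ^ j"
      unfolding c_def k_def using off False unfolding k_def by (intro step_weight_off_level) simp_all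
    then show ?thesis using off by simp
  qed
  then have "real n * suminf (step_weight n) \<le> 1 / exp 1 + c * (1 / (1 - 1/2))"
    by (rule sums_le[OF _ sums sums_bound])
  also have "\<dots> = 1 / exp 1 + 4 * (1/2) ^ level n" unfolding c_def k_def by simp
  finally show ?thesis .
qed

lemma limsup_le_of_level_bound:
  assumes "\<And>n. a n \<le> 1 / exp 1 + 4 * (1/2) ^ level n"
  shows "limsup (\<lambda>n. ereal (a n)) \<le> ereal (1 / exp 1)"
proof -
  have "(\<lambda>n. (1/2 :: real) ^ level n) \<longlonglongrightarrow> 0"
    by (rule filterlim_compose[OF LIMSEQ_power_zero filterlim_level]) simp
  then have "(\<lambda>n. 1 / exp 1 + 4 * (1/2) ^ level n) \<longlonglongrightarrow> 1 / exp 1 + 4 * (0 :: real)"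
    by (intro tendsto_intros)
  then have "(\<lambda>n. ereal (1 / exp 1 + 4 * (1/2) ^ level n)) \<longlonglongrightarrow> ereal (1 / exp 1)" by simp
  then have "limsup (\<lambda>n. ereal (1 / exp 1 + 4 * (1/2) ^ level n)) = ereal (1 / exp 1)"
    by (intro lim_imp_Limsup) simp_all
  then show ?thesis
    using Limsup_mono[of "\<lambda>n. ereal (a n)" "\<lambda>n. ereal (1 / exp 1 + 4 * (1/2) ^ level n)" sequentially] assms
    by simp
qed

text \<open>Each of the first \<open>J\<close> terms tends to \<open>1\<close>, so their sum eventually exceeds any number below \<open>J\<close>.\<close>

lemma filterlim_sum_one_minus_rate_power:
  assumes "\<And>n J. (\<Sum>j<J. 1 - (1 - rate j) ^ n) \<le> a n"
  shows "filterlim a at_top sequentially"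
  unfolding filterlim_at_top
proof
  fix B :: real
  obtain J where J: "B < real J" using reals_Archimedean2 by blast
  have "(\<lambda>n. \<Sum>j<J. 1 - (1 - rate j) ^ n) \<longlonglongrightarrow> (\<Sum>j<J. 1 - 0)"
  proof (intro tendsto_intros LIMSEQ_power_zero)
    show "norm (1 - rate j) < 1" for j using rate_pos[of j] rate_le_1[of j] by simp
  qed
  then have "\<forall>\<^sub>F n in sequentially. B < (\<Sum>j<J. 1 - (1 - rate j) ^ n)"
    using J by (intro order_tendstoD(1)) auto
  then show "\<forall>\<^sub>F n in sequentially. B \<le> a n"
  proof eventually_elim
    case (elim n)
    then show ?case using assms[where n = n and J = J] by linarith
  qed
qed

section \<open>Weighted sums of mutually annihilating projections\<close>

locale annihilating_projections =
  fixes P :: "nat \<Rightarrow> 'a::cbanach \<Rightarrow> 'a" and C :: real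
  assumes bounded_clinear_P: "bounded_clinear (P j)"
    and P_P: "P i (P j x) = (if i = j then P j x else 0)"
    and norm_P_le: "norm (P j x) \<le> C * norm x"
    and C_nonneg: "0 \<le> C"
begin

lemma bounded_linear_P: "bounded_linear (P j)"
  using bounded_clinear_P unfolding bounded_clinear_def by blast

lemma linear_P: "linear (P j)"
  by (rule bounded_linear.linear[OF bounded_linear_P])

definition weighted :: "(nat \<Rightarrow> real) \<Rightarrow> 'a \<Rightarrow> 'a" where
  "weighted c x = (\<Sum>j. c j *\<^sub>R P j x)"

context
  fixes c :: "nat \<Rightarrow> real"
  assumes summable_c: "summable c" and c_nonneg: "\<And>j. 0 \<le> c j"
begin

lemma summable_norm_weighted: "summable (\<lambda>j. norm (c j *\<^sub>R P j x))"
proof (rule summable_comparison_test'[OF summable_mult2[OF summable_c]])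
  show "norm (norm (c j *\<^sub>R P j x)) \<le> c j * (C * norm x)" for j
    using norm_P_le c_nonneg by (simp add: mult_left_mono)
qed

lemma sums_weighted: "(\<lambda>j. c j *\<^sub>R P j x) sums weighted c x"
  unfolding weighted_def
  by (rule summable_sums[OF summable_norm_cancel[OF summable_norm_weighted]])

lemma norm_weighted_le:
  assumes "\<And>j. norm (P j x) \<le> b"
  shows "norm (weighted c x) \<le> suminf c * b"
proof -
  have "norm (weighted c x) \<le> (\<Sum>j. norm (c j *\<^sub>R P j x))"
    unfolding weighted_def by (rule summable_norm[OF summable_norm_weighted])
  also have "\<dots> \<le> (\<Sum>j. c j * b)"
    using assms c_nonneg
    by (intro suminf_le summable_norm_weighted summable_mult2 summable_c)
       (simp add: mult_left_mono)
  also have "\<dots> = suminf c * b" using suminf_mult2[OF summable_c] by simp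
  finally show ?thesis .
qed

lemma P_weighted: "P i (weighted c x) = c i *\<^sub>R P i x"
proof -
  have "(\<lambda>j. P i (c j *\<^sub>R P j x)) sums P i (weighted c x)"
    by (rule bounded_linear.sums[OF bounded_linear_P sums_weighted])
  moreover have "(\<lambda>j. P i (c j *\<^sub>R P j x)) = (\<lambda>j. if j = i then c j *\<^sub>R P j x else 0)"
    by (auto simp: linear_scale[OF linear_P] P_P)
  moreover have "(\<lambda>j. if j = i then c j *\<^sub>R P j x else 0) sums (c i *\<^sub>R P i x)"
    by (rule sums_single)
  ultimately show ?thesis by (metis sums_unique2)
qed

lemma weighted_P: "weighted c (P i x) = c i *\<^sub>R P i x"
proof -
  have "(\<lambda>j. c j *\<^sub>R P j (P i x)) = (\<lambda>j. if j = i then c j *\<^sub>R P j x else 0)"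
    by (auto simp: P_P)
  then show ?thesis
    using sums_weighted[of "P i x"] sums_single[of i "\<lambda>j. c j *\<^sub>R P j x"]
    by (metis sums_unique2)
qed

lemma bounded_clinear_weighted: "bounded_clinear (weighted c)"
proof -
  have scale: "weighted c (a *\<^sub>C x) = a *\<^sub>C weighted c x" for a x
  proof (rule sums_unique2[OF sums_weighted])
    have "(\<lambda>j. a *\<^sub>C (c j *\<^sub>R P j x)) sums (a *\<^sub>C weighted c x)"
      by (rule bounded_linear.sums[OF bounded_linear_scaleC_right sums_weighted])
    then show "(\<lambda>j. c j *\<^sub>R P j (a *\<^sub>C x)) sums (a *\<^sub>C weighted c x)"
      using bounded_clinear_P unfolding bounded_clinear_def
      by (simp add: scaleR_scaleC scaleC_scaleC mult.commute)
  qed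
  have "bounded_linear (weighted c)"
  proof (rule bounded_linear_intro)
    fix x y
    have "(\<lambda>j. c j *\<^sub>R P j (x + y)) sums (weighted c x + weighted c y)"
      using sums_add[OF sums_weighted[of x] sums_weighted[of y]]
      by (simp add: linear_add[OF linear_P] scaleR_add_right)
    then show "weighted c (x + y) = weighted c x + weighted c y"
      by (rule sums_unique2[OF sums_weighted])
    show "weighted c (r *\<^sub>R x) = r *\<^sub>R weighted c x" for r by (simp add: scaleR_scaleC scale)
    show "norm (weighted c x) \<le> norm x * (suminf c * C)"
      using norm_weighted_le[of x "C * norm x"] norm_P_le by (simp add: mult_ac)
  qed
  with scale show ?thesis unfolding bounded_clinear_def by blast
qed

end

definition T :: "'a \<Rightarrow> 'a" where
  "T x = x - weighted rate x"

lemma bounded_clinear_T: "bounded_clinear T"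
proof -
  have w: "bounded_clinear (weighted rate)"
    by (rule bounded_clinear_weighted[OF summable_rate less_imp_le[OF rate_pos]])
  then have "bounded_linear (\<lambda>x. x - weighted rate x)"
    unfolding bounded_clinear_def by (intro bounded_linear_sub bounded_linear_ident) blast
  with w show ?thesis
    unfolding bounded_clinear_def T_def[abs_def]
    by (simp add: complex_vector.scale_right_diff_distrib)
qed

lemma bounded_linear_T_power: "bounded_linear (T ^^ n)"
proof (induction n)
  case 0
  then show ?case by (simp add: id_def bounded_linear_ident)
next
  case (Suc n)
  then show ?case
    using bounded_clinear_T bounded_linear_compose[of T "T ^^ n"]
    unfolding bounded_clinear_def by (simp add: o_def)
qed

lemma T_power_P: "(T ^^ n) (P j x) = (1 - rate j) ^ n *\<^sub>R P j x"
proof (induction n)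
  case (Suc n)
  have "T (P j x) = (1 - rate j) *\<^sub>R P j x"
    unfolding T_def weighted_P[OF summable_rate less_imp_le[OF rate_pos]]
    by (simp add: scaleR_diff_left)
  then have "T ((1 - rate j) ^ n *\<^sub>R P j x) = (1 - rate j) ^ Suc n *\<^sub>R P j x"
    using bounded_clinear_T unfolding bounded_clinear_def
    by (simp add: linear_scale bounded_linear.linear mult.commute)
  with Suc show ?case by simp
qed simp

lemma T_power_diff: "(T ^^ (n + 1)) x - (T ^^ n) x = - weighted (step_weight n) x"
proof -
  have "(\<lambda>j. (T ^^ n) (rate j *\<^sub>R P j x)) sums (T ^^ n) (weighted rate x)"
    by (intro bounded_linear.sums[OF bounded_linear_T_power] sums_weighted summable_rate
        less_imp_le[OF rate_pos])
  then have "(\<lambda>j. step_weight n j *\<^sub>R P j x) sums (T ^^ n) (weighted rate x)"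
    by (simp add: linear_scale[OF bounded_linear.linear[OF bounded_linear_T_power]] T_power_P
        step_weight_def)
  then have "weighted (step_weight n) x = (T ^^ n) (weighted rate x)"
    unfolding weighted_def by (rule sums_unique[symmetric])
  moreover have "(T ^^ (n + 1)) x = (T ^^ n) x - (T ^^ n) (weighted rate x)"
    by (simp add: funpow_swap1 T_def linear_diff[OF bounded_linear.linear[OF bounded_linear_T_power]])
  ultimately show ?thesis by simp
qed

lemma sums_T_power: "(\<lambda>j. (1 - (1 - rate j) ^ n) *\<^sub>R P j x) sums (x - (T ^^ n) x)"
proof (induction n)
  case (Suc n)
  have "(\<lambda>j. step_weight n j *\<^sub>R P j x) sums weighted (step_weight n) x"
    by (intro sums_weighted summable_step_weight step_weight_nonneg)
  from sums_add[OF Suc this]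
  have "(\<lambda>j. (1 - (1 - rate j) ^ n + step_weight n j) *\<^sub>R P j x)
      sums (x - (T ^^ n) x + weighted (step_weight n) x)"
    by (simp add: scaleR_add_left)
  moreover have "1 - (1 - rate j) ^ n + step_weight n j = 1 - (1 - rate j) ^ Suc n" for j
    by (simp add: step_weight_def algebra_simps)
  moreover have "x - (T ^^ n) x + weighted (step_weight n) x = x - (T ^^ Suc n) x"
    using T_power_diff[of n x] by (simp add: diff_eq_eq)
  ultimately show ?case by (simp only:)
qed simp

lemma onorm_T_power_diff_le: "onorm (\<lambda>x. (T ^^ (n + 1)) x - (T ^^ n) x) \<le> suminf (step_weight n) * C"
proof (rule onorm_bound)
  show "0 \<le> suminf (step_weight n) * C"
    by (intro mult_nonneg_nonneg suminf_nonneg summable_step_weight step_weight_nonneg C_nonneg)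
  show "norm ((T ^^ (n + 1)) x - (T ^^ n) x) \<le> suminf (step_weight n) * C * norm x" for x
    using norm_weighted_le[OF summable_step_weight step_weight_nonneg norm_P_le]
    unfolding T_power_diff by (simp add: mult.assoc)
qed

text \<open>
  Applied to \<open>b - T\<^sup>n b\<close>, the functional \<open>\<phi>\<close> gives exactly the sum of the coefficients
  \<open>1 - (1 - rate j) ^ n\<close>: the contributions of the \<open>P\<^sub>j\<close> all point in the same direction.
\<close>

lemma onorm_T_power_at_top:
  assumes \<phi>: "bounded_linear \<phi>" and P\<phi>: "\<And>j. \<phi> (P j b) = (1 :: complex)"
  shows "filterlim (\<lambda>n. onorm (T ^^ n)) at_top sequentially"
proof -
  \<comment> \<open>the summand \<open>1\<close> only makes the factor \<open>K\<close> positive\<close>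
  define K where "K = onorm \<phi> * norm b + 1"
  have nonneg: "0 \<le> onorm \<phi> * norm b" using onorm_pos_le[OF \<phi>] by simp
  then have K: "0 < K" unfolding K_def by simp
  have "(\<Sum>j<J. 1 - (1 - rate j) ^ n) \<le> K * onorm (T ^^ n) + cmod (\<phi> b)" for n J
  proof -
    have "(\<lambda>j. \<phi> ((1 - (1 - rate j) ^ n) *\<^sub>R P j b)) sums \<phi> (b - (T ^^ n) b)"
      by (rule bounded_linear.sums[OF \<phi> sums_T_power])
    then have "(\<lambda>j. of_real (1 - (1 - rate j) ^ n)) sums \<phi> (b - (T ^^ n) b)"
      by (simp add: linear_scale[OF bounded_linear.linear[OF \<phi>]] P\<phi> scaleR_conv_of_real)
    then have s: "(\<lambda>j. 1 - (1 - rate j) ^ n) sums Re (\<phi> (b - (T ^^ n) b))"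
      using sums_Re by fastforce
    have "(\<Sum>j<J. 1 - (1 - rate j) ^ n) \<le> Re (\<phi> (b - (T ^^ n) b))"
      unfolding sums_unique[OF s] using rate_pos rate_le_1 sums_summable[OF s]
      by (intro sum_le_suminf) (auto simp: power_le_one less_imp_le)
    also have "\<dots> \<le> cmod (\<phi> b - \<phi> ((T ^^ n) b))"
      unfolding linear_diff[OF bounded_linear.linear[OF \<phi>]] by (rule complex_Re_le_cmod)
    also have "\<dots> \<le> cmod (\<phi> b) + cmod (\<phi> ((T ^^ n) b))" by (rule norm_triangle_ineq4)
    also have "cmod (\<phi> ((T ^^ n) b)) \<le> onorm \<phi> * norm ((T ^^ n) b)" by (rule onorm[OF \<phi>])
    also have "\<dots> \<le> onorm \<phi> * (onorm (T ^^ n) * norm b)"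
      by (intro mult_left_mono onorm[OF bounded_linear_T_power] onorm_pos_le[OF \<phi>])
    also have "\<dots> \<le> K * onorm (T ^^ n)"
      using onorm_pos_le[OF bounded_linear_T_power, of n] unfolding K_def
      by (simp add: algebra_simps)
    finally show ?thesis by simp
  qed
  then have "filterlim (\<lambda>n. K * onorm (T ^^ n) + cmod (\<phi> b)) at_top sequentially"
    by (rule filterlim_sum_one_minus_rate_power)
  then show ?thesis
    unfolding filterlim_at_top
  proof (intro allI)
    fix B :: real
    assume "\<forall>Z. \<forall>\<^sub>F n in sequentially. Z \<le> K * onorm (T ^^ n) + cmod (\<phi> b)"
    then have "\<forall>\<^sub>F n in sequentially. K * B + cmod (\<phi> b) \<le> K * onorm (T ^^ n) + cmod (\<phi> b)"
      by blast
    then show "\<forall>\<^sub>F n in sequentially. B \<le> onorm (T ^^ n)"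
      by eventually_elim (use K in simp)
  qed
qed

text \<open>
  The new norm makes every \<open>P\<^sub>i\<close> a contraction, since \<open>P\<^sub>j P\<^sub>i\<close> is either \<open>P\<^sub>i\<close> or \<open>0\<close>. A weighted
  sum of the \<open>P\<^sub>j\<close> then has norm at most the sum of its weights.
\<close>

definition N :: "'a \<Rightarrow> real" where
  "N x = max (norm x) (SUP j. norm (P j x))"

lemma N_le_iff: "N x \<le> b \<longleftrightarrow> norm x \<le> b \<and> (\<forall>j. norm (P j x) \<le> b)"
proof -
  have "bdd_above (range (\<lambda>j. norm (P j x)))" by (rule bdd_aboveI2) (rule norm_P_le)
  then show ?thesis unfolding N_def by (simp add: cSUP_le_iff)
qed

lemma norm_le_N: "norm x \<le> N x" and norm_P_le_N: "norm (P j x) \<le> N x"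
  using N_le_iff[of x "N x"] by auto

lemma equivalent_norm_N: "equivalent_norm N"
proof -
  have zero: "N x = 0 \<longleftrightarrow> x = 0" for x
    using norm_le_N[of x] N_le_iff[of 0 0] linear_0[OF linear_P] norm_le_N[of 0] by force
  have triangle: "N (x + y) \<le> N x + N y" for x y
    unfolding N_le_iff linear_add[OF linear_P]
    by (intro conjI allI norm_triangle_le add_mono norm_le_N norm_P_le_N)
  have scale_le: "N (a *\<^sub>C x) \<le> cmod a * N x" for a x
    using bounded_clinear_P unfolding N_le_iff bounded_clinear_def
    by (simp add: norm_scaleC mult_left_mono norm_le_N norm_P_le_N)
  have scale: "N (a *\<^sub>C x) = cmod a * N x" for a x
  proof (cases "a = 0")
    case True
    then show ?thesis using zero[of 0] by simp
  next
    case False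
    then have "N x \<le> cmod (inverse a) * N (a *\<^sub>C x)"
      using scale_le[of "inverse a" "a *\<^sub>C x"] by (simp add: scaleC_scaleC scaleC_one)
    then have "cmod a * N x \<le> cmod a * (cmod (inverse a) * N (a *\<^sub>C x))"
      by (intro mult_left_mono) simp_all
    also have "\<dots> = N (a *\<^sub>C x)" using False by (simp add: norm_inverse)
    finally show ?thesis using scale_le[of a x] by simp
  qed
  have le: "N x \<le> (1 + C) * norm x" for x
    unfolding N_le_iff using norm_P_le C_nonneg by (auto simp: algebra_simps intro: add_increasing)
  have "0 < 1 + C" using C_nonneg by simp
  moreover have "\<forall>x. 1 * norm x \<le> N x \<and> N x \<le> (1 + C) * norm x" using norm_le_N le by simp
  ultimately have "\<exists>a>0. \<exists>b>0. \<forall>x. a * norm x \<le> N x \<and> N x \<le> b * norm x" using zero_less_one by blast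
  moreover have "0 \<le> N x" for x using norm_le_N[of x] norm_ge_zero[of x] by linarith
  ultimately show ?thesis unfolding equivalent_norm_def is_cnorm_def
    using zero triangle scale by blast
qed

lemma N_weighted_le:
  assumes c: "summable c" "\<And>j. 0 \<le> c j"
  shows "N (weighted c x) \<le> suminf c * N x"
proof -
  have "c i \<le> suminf c" for i
    using sum_le_suminf[OF c(1), of "{i}"] c(2) by simp
  then have "norm (P i (weighted c x)) \<le> suminf c * N x" for i
    unfolding P_weighted[OF c] using c(2) norm_P_le_N[of i x]
    by (simp add: mult_mono order_trans[OF c(2)])
  then show ?thesis
    unfolding N_le_iff using norm_weighted_le[OF c norm_P_le_N] by blast
qed

lemma onorm_wrt_N_T_power_diff_le:
  "onorm_wrt N (\<lambda>x. (T ^^ (n + 1)) x - (T ^^ n) x) \<le> suminf (step_weight n)"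
  unfolding onorm_wrt_def
proof (rule cSUP_least)
  fix x
  have nonneg: "0 \<le> suminf (step_weight n)"
    by (intro suminf_nonneg summable_step_weight step_weight_nonneg)
  have "N (- y) = N y" for y by (simp add: N_def linear_neg[OF linear_P])
  then have "N ((T ^^ (n + 1)) x - (T ^^ n) x) \<le> suminf (step_weight n) * N x"
    unfolding T_power_diff using N_weighted_le[OF summable_step_weight step_weight_nonneg] by simp
  moreover have "0 \<le> N x" using norm_le_N[of x] norm_ge_zero[of x] by linarith
  ultimately show "N ((T ^^ (n + 1)) x - (T ^^ n) x) / N x \<le> suminf (step_weight n)"
    using nonneg by (cases "N x = 0") (simp_all add: divide_le_eq)
qed simp

end

section \<open>Unbounded powers from a biorthogonal sequence\<close>

theorem theorem3p4:
  assumes "infinite_dimensional TYPE('a::cbanach)"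
  shows "\<exists>T :: 'a \<Rightarrow> 'a. bounded_clinear T \<and>
    limsup (\<lambda>n. ereal (real n * onorm (\<lambda>x. (T ^^ (n + 1)) x - (T ^^ n) x))) < \<infinity> \<and>
    filterlim (\<lambda>n. onorm (T ^^ n)) at_top sequentially \<and>
    (\<exists>N :: 'a \<Rightarrow> real. equivalent_norm N \<and>
      limsup (\<lambda>n. ereal (real n * onorm_wrt N (\<lambda>x. (T ^^ (n + 1)) x - (T ^^ n) x)))
        \<le> ereal (1 / exp 1))"
proof -
  obtain u :: "nat \<Rightarrow> 'a" and f
    where u: "\<And>n. norm (u n) = 1" and f: "\<And>n. cfunctional (f n)"
      and f_le: "\<And>n x. cmod (f n x) \<le> 4 * norm x"
      and fu: "\<And>m n. f m (u n) = of_bool (m = n)"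
    using exists_biorthogonal_sequence[OF assms] by metis
  \<comment> \<open>index \<open>0\<close> supplies the common direction \<open>u 0\<close>, which all \<open>g j\<close> kill, and index \<open>1\<close> the
    common functional \<open>f 1\<close>, which kills all vectors \<open>u (j + 2) + u 0\<close>\<close>
  define g where "g j x = f (j + 2) x + f 1 x" for j x
  define P where "P j x = g j x *\<^sub>C (u (j + 2) + u 0)" for j x
  have g: "cfunctional (g j)" for j
    using f unfolding cfunctional_def g_def[abs_def]
    by (auto intro: bounded_linear_add simp: distrib_left)
  have gu: "g i (u (j + 2) + u 0) = of_bool (i = j)" for i j
    unfolding g_def by (simp add: linear_add[OF cfunctional_linear[OF f]] fu)
  interpret annihilating_projections P 16
  proof
    fix i j x
    show "bounded_clinear (P j)"
      using bounded_linear_compose[OF bounded_linear_scaleC_left, of "g j"] g[of j]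
      unfolding bounded_clinear_def cfunctional_def P_def[abs_def] by (simp add: scaleC_scaleC)
    show "P i (P j x) = (if i = j then P j x else 0)"
      unfolding P_def cfunctional_scaleC[OF g] gu by simp
    have "cmod (g j x) \<le> 8 * norm x"
      unfolding g_def using norm_triangle_ineq[of "f (j + 2) x" "f 1 x"] f_le[of "j + 2" x] f_le[of 1 x]
      by simp
    moreover have "norm (u (j + 2) + u 0) \<le> 2"
      using norm_triangle_ineq[of "u (j + 2)" "u 0"] u by simp
    ultimately show "norm (P j x) \<le> 16 * norm x"
      unfolding P_def norm_scaleC
      using mult_mono[of "cmod (g j x)" "8 * norm x" "norm (u (j + 2) + u 0)" 2] by simp
  qed simp
  have "filterlim (\<lambda>n. onorm (T ^^ n)) at_top sequentially"
  proof (rule onorm_T_power_at_top)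
    show "bounded_linear (f 0)" using f unfolding cfunctional_def by blast
    show "f 0 (P j (u 1)) = 1" for j
      unfolding P_def cfunctional_scaleC[OF f]
      by (simp add: linear_add[OF cfunctional_linear[OF f]] g_def fu)
  qed
  moreover have "limsup (\<lambda>n. ereal (real n * onorm (\<lambda>x. (T ^^ (n + 1)) x - (T ^^ n) x))) < \<infinity>"
  proof -
    have "real n * onorm (\<lambda>x. (T ^^ (n + 1)) x - (T ^^ n) x) \<le> (1 / exp 1 + 4) * 16" for n
    proof -
      have "real n * onorm (\<lambda>x. (T ^^ (n + 1)) x - (T ^^ n) x)
          \<le> (real n * suminf (step_weight n)) * 16"
        using mult_left_mono[OF onorm_T_power_diff_le[of n], of "real n"] by simp
      also have "real n * suminf (step_weight n) \<le> 1 / exp 1 + 4"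
        using suminf_step_weight_le[of n] power_le_one[of "1/2 :: real" "level n"] by simp
      finally show ?thesis by simp
    qed
    then have "limsup (\<lambda>n. ereal (real n * onorm (\<lambda>x. (T ^^ (n + 1)) x - (T ^^ n) x)))
        \<le> ereal ((1 / exp 1 + 4) * 16)"
      by (intro Limsup_bounded always_eventually) simp
    then show ?thesis by (rule le_less_trans) simp
  qed
  moreover have "limsup (\<lambda>n. ereal (real n * onorm_wrt N (\<lambda>x. (T ^^ (n + 1)) x - (T ^^ n) x)))
      \<le> ereal (1 / exp 1)"
  proof (rule limsup_le_of_level_bound)
    fix n
    have "real n * onorm_wrt N (\<lambda>x. (T ^^ (n + 1)) x - (T ^^ n) x) \<le> real n * suminf (step_weight n)"
      by (intro mult_left_mono onorm_wrt_N_T_power_diff_le) simp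
    also have "\<dots> \<le> 1 / exp 1 + 4 * (1/2) ^ level n" by (rule suminf_step_weight_le)
    finally show "real n * onorm_wrt N (\<lambda>x. (T ^^ (n + 1)) x - (T ^^ n) x)
        \<le> 1 / exp 1 + 4 * (1/2) ^ level n" .
  qed
  ultimately show ?thesis
    using bounded_clinear_T equivalent_norm_N by (intro exI[of _ T] exI[of _ N] conjI)
qed

end
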